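(* Let $\mathbf{X} = \mathbb{R}^n$, let $g:\mathbf{X}\to\mathbb{R}$ be a differentiable function, and let $\mathbf{x}^*\in\mathbf{X}$ be a minimum point of $g$. Suppose that for every $\mathbf{x}\in\mathbf{X}$ with $\mathbf{x}\neq\mathbf{x}^*$, $$\nabla g(\mathbf{x})\cdot\frac{\mathbf{x}-\mathbf{x}^*}{\|\mathbf{x}-\mathbf{x}^*\|} > 0 .$$ Then $g$ is an invex function.
   Context: Here $\cdot$ and $\|\cdot\|$ denote the Euclidean inner product and norm on $\mathbb{R}^n$. A differentiable function $f:\mathbf{X}\to\mathbb{R}$ on $\mathbf{X}=\mathbb{R}^n$ is called invex if there exists a function $\eta:\mathbf{X}\times\mathbf{X}\to\mathbb{R}^n$ such that for all $\mathbf{x}_1,\mathbf{x}_2\in\mathbf{X}$, $$f(\mathbf{x}_1)-f(\mathbf{x}_2)\ \geq\ \eta(\mathbf{x}_1,\mathbf{x}_2)\cdot\nabla f(\mathbf{x}_2).$$ *)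

theory Defs
  imports "HOL-Analysis.Analysis"
begin

definition grad :: "('a::euclidean_space \<Rightarrow> real) \<Rightarrow> 'a \<Rightarrow> 'a" where
  "grad f x = (THE D. GDERIV f x :> D)"

lemma GDERIV_grad:
  fixes f :: "'a::euclidean_space \<Rightarrow> real"
  assumes "f differentiable (at x)"
  shows "GDERIV f x :> grad f x"
proof -
  obtain f' where f': "(f has_derivative f') (at x)"
    using assms by (auto simp: differentiable_def)
  then interpret bounded_linear f' by (rule has_derivative_bounded_linear)
  have "f' h = h \<bullet> adjoint f' 1" for h
    using adjoint_works[OF linear_axioms, of h 1] by simp
  then have "f' = (\<lambda>h. h \<bullet> adjoint f' 1)" by blast
  with f' have ex: "GDERIV f x :> adjoint f' 1"
    by (simp add: gderiv_def)
  have uniq: "D = E" if "GDERIV f x :> D" "GDERIV f x :> E" for D E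
  proof -
    have "(\<lambda>h. h \<bullet> D) = (\<lambda>h. h \<bullet> E)"
      using that has_derivative_unique unfolding gderiv_def by blast
    then have "\<forall>h. h \<bullet> D = h \<bullet> E" by meson
    then show ?thesis by (simp add: vector_eq_ldot)
  qed
  show ?thesis
    unfolding grad_def using ex uniq by (metis (no_types, lifting) theI)
qed

definition invex :: "('a::euclidean_space \<Rightarrow> real) \<Rightarrow> bool" where
  "invex f \<longleftrightarrow>
     (\<forall>x. f differentiable (at x)) \<and>
     (\<exists>\<eta> :: 'a \<times> 'a \<Rightarrow> 'a. \<forall>x1 x2. f x1 - f x2 \<ge> \<eta> (x1, x2) \<bullet> grad f x2)"

end

theory Submission
  imports Defs
begin

text \<open>Invexity holds as soon as every stationary point is a global minimum, and positivity of
  the radial derivative rules out stationary points other than \<open>xs\<close>.\<close>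

theorem proposition2:
  fixes g :: "real ^ 'n \<Rightarrow> real" and xs :: "real ^ 'n"
  assumes "\<And>x. g differentiable (at x)"
    and "\<And>x. g xs \<le> g x"
    and "\<And>x. x \<noteq> xs \<Longrightarrow> grad g x \<bullet> ((x - xs) /\<^sub>R norm (x - xs)) > 0"
  shows "invex g"
proof -
  \<comment> \<open>Off \<open>xs\<close>, the multiple of the gradient is scaled to give equality
    in the invexity condition; at \<open>xs\<close>, the value 0 leaves just minimality.\<close>
  define \<eta> where "\<eta> = (\<lambda>(x1, x2).
    if x2 = xs then 0
    else ((g x1 - g x2) / (grad g x2 \<bullet> grad g x2)) *\<^sub>R grad g x2)"
  have "g x1 - g x2 \<ge> \<eta> (x1, x2) \<bullet> grad g x2" for x1 x2
  proof (cases "x2 = xs")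
    case True
    then show ?thesis
      using assms(2)[of x1] by (simp add: \<eta>_def)
  next
    case False
    \<comment> \<open>A zero gradient would make the positive inner product vanish; so the division
      in \<open>\<eta>\<close> is genuine.\<close>
    then have "grad g x2 \<noteq> 0"
      using assms(3)[of x2] by auto
    with False show ?thesis
      by (simp add: \<eta>_def)
  qed
  with assms(1) show ?thesis
    unfolding invex_def by blast
qed

end
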